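(* Let $\phi(z)=\frac{az+b}{cz+d}$, with $a,b,c,d\in\mathbb{C}$ and $ad-bc\neq 0$, be a linear fractional self-map of $\mathbb{D}$ such that $c=0$. Then $C_\phi$ is 2-complex symmetric with $J$ on $H^2(\mathbb{D})$ if and only if $C_\phi$ is normal.
   Context: $H^2(\mathbb{D})$ is the Hardy space of analytic functions $f$ on the open unit disk $\mathbb{D}\subset\mathbb{C}$ with $\|f\|^2=\sup_{0<r<1}\frac{1}{2\pi}\int_0^{2\pi}|f(re^{i\theta})|^2d\theta<\infty$, a Hilbert space. For an analytic self-map $\phi$ of $\mathbb{D}$, the composition operator $C_\phi$ is the bounded operator on $H^2(\mathbb{D})$ given by $C_\phi f=f\circ\phi$. $J$ is the conjugation on $H^2(\mathbb{D})$ given by $(Jf)(z)=\overline{f(\bar z)}$. A bounded linear operator $T$ on $H^2(\mathbb{D})$ is said to be 2-complex symmetric with $J$ if $JT^2J-2T^*JTJ+(T^* )^2=0$ (equivalently $JT^2-2T^*JT+(T^* )^2J=0$). A linear fractional self-map of $\mathbb{D}$ is a map $z\mapsto\frac{az+b}{cz+d}$ with $ad-bc\ne0$ that is analytic on $\mathbb{D}$ and maps $\mathbb{D}$ into $\mathbb{D}$. *)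

theory Defs
  imports "HOL-Complex_Analysis.Complex_Analysis"
begin

abbreviation unit_disk :: "complex set" ("\<D>") where
  "\<D> \<equiv> ball 0 1"

definition mean_square :: "(complex \<Rightarrow> complex) \<Rightarrow> real \<Rightarrow> real" where
  "mean_square f r =
     1 / (2 * pi) * integral {0..2 * pi} (\<lambda>t. (cmod (f (of_real r * cis t)))\<^sup>2)"

text \<open>
  A function on the disk is represented by its extension by zero, so that HOL equality
  of elements of \<open>hardy2\<close> is equality as functions on the disk and pointwise operations
  stay within the representation.
\<close>

definition hardy2 :: "(complex \<Rightarrow> complex) set" where
  "hardy2 = {f. f holomorphic_on \<D> \<and> bdd_above (mean_square f ` {0<..<1}) \<and>
                (\<forall>z. z \<notin> \<D> \<longrightarrow> f z = 0)}"

definition hardy_norm :: "(complex \<Rightarrow> complex) \<Rightarrow> real" where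
  "hardy_norm f = sqrt (SUP r\<in>{0<..<1}. mean_square f r)"

text \<open>
  The inner product is the one determined by the norm through polarization; it is linear
  in the first and conjugate-linear in the second argument.
\<close>

definition hardy_inner :: "(complex \<Rightarrow> complex) \<Rightarrow> (complex \<Rightarrow> complex) \<Rightarrow> complex" where
  "hardy_inner f g =
     (\<Sum>k<4. \<i> ^ k * of_real ((hardy_norm (\<lambda>z. f z + \<i> ^ k * g z))\<^sup>2)) / 4"

text \<open>
  Operators are total HOL functions of which only the restriction to \<open>hardy2\<close> matters.
\<close>

type_synonym hardy_operator = "(complex \<Rightarrow> complex) \<Rightarrow> (complex \<Rightarrow> complex)"

definition hardy_bounded_operator :: "hardy_operator \<Rightarrow> bool" where
  "hardy_bounded_operator T \<longleftrightarrow>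
     (\<forall>f\<in>hardy2. T f \<in> hardy2) \<and>
     (\<forall>f\<in>hardy2. \<forall>g\<in>hardy2. T (\<lambda>z. f z + g z) = (\<lambda>z. T f z + T g z)) \<and>
     (\<forall>\<alpha>::complex. \<forall>f\<in>hardy2. T (\<lambda>z. \<alpha> * f z) = (\<lambda>z. \<alpha> * T f z)) \<and>
     (\<exists>K. \<forall>f\<in>hardy2. hardy_norm (T f) \<le> K * hardy_norm f)"

definition hardy_adjoint :: "hardy_operator \<Rightarrow> hardy_operator" where
  "hardy_adjoint T g =
     (THE h. h \<in> hardy2 \<and> (\<forall>f\<in>hardy2. hardy_inner (T f) g = hardy_inner f h))"

definition hardy_normal :: "hardy_operator \<Rightarrow> bool" where
  "hardy_normal T \<longleftrightarrow>
     hardy_bounded_operator T \<and>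
     (\<forall>f\<in>hardy2. hardy_adjoint T (T f) = T (hardy_adjoint T f))"

definition hardy_J :: hardy_operator where
  "hardy_J f = (\<lambda>z. cnj (f (cnj z)))"

text \<open>The defining identity is \<open>C T\<^sup>2 C - 2 T\<^sup>* C T C + (T\<^sup>*)\<^sup>2 = 0\<close>, for a conjugation \<open>C\<close>.\<close>

definition two_complex_symmetric :: "hardy_operator \<Rightarrow> hardy_operator \<Rightarrow> bool" where
  "two_complex_symmetric C T \<longleftrightarrow>
     hardy_bounded_operator T \<and>
     (\<forall>f\<in>hardy2. \<forall>z.
        C (T (T (C f))) z
        - 2 * hardy_adjoint T (C (T (C f))) z
        + hardy_adjoint T (hardy_adjoint T f) z = 0)"

definition composition_operator :: "(complex \<Rightarrow> complex) \<Rightarrow> hardy_operator" where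
  "composition_operator \<phi> f = (\<lambda>z. if z \<in> \<D> then f (\<phi> z) else 0)"

definition disk_self_map :: "(complex \<Rightarrow> complex) \<Rightarrow> bool" where
  "disk_self_map \<phi> \<longleftrightarrow> \<phi> holomorphic_on \<D> \<and> \<phi> ` \<D> \<subseteq> \<D>"

end

theory Submission
  imports Defs
begin

text \<open>
  By Parseval's identity, \<open>hardy_inner\<close> is the \<open>\<ell>\<^sup>2\<close> inner product of Taylor coefficients, so the
  Szego kernels \<open>K w\<close> reproduce point values and \<open>C\<^sup>* (K w) = K (\<phi> w)\<close> for \<open>C = C_\<phi>\<close>.
  Both conditions, tested on the constant \<open>1 = K 0\<close>, force \<open>\<phi> 0 = 0\<close>: normality gives
  \<open>K (\<phi> 0) = K (\<phi> 0) \<circ> \<phi>\<close>, to be evaluated at \<open>0\<close>, and 2-complex symmetry gives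
  \<open>1 - 2 K (\<phi> 0) + K (\<phi> (\<phi> 0)) = 0\<close>. An affine \<open>\<phi>\<close> fixing \<open>0\<close> is \<open>z \<mapsto> \<alpha> z\<close>, and then \<open>C\<close> is
  diagonal with respect to the monomials and satisfies both conditions.
\<close>

section \<open>Taylor expansions on the disk\<close>

text \<open>The coefficients are a parameter instead of being computed from derivatives, so sums,
  monomials, kernels and dilations are handled by naming theirs. The clause outside \<D> matches the
  extension by zero in \<open>hardy2\<close>; membership in \<open>hardy2\<close> becomes a separate
  summability condition on \<open>u\<close>.\<close>

definition taylor_on_disk :: "(nat \<Rightarrow> complex) \<Rightarrow> (complex \<Rightarrow> complex) \<Rightarrow> bool" where
  "taylor_on_disk u f \<longleftrightarrow> (\<forall>z\<in>\<D>. (\<lambda>n. u n * z ^ n) sums f z) \<and> (\<forall>z. z \<notin> \<D> \<longrightarrow> f z = 0)"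

lemma taylor_on_disk_sums:
  "taylor_on_disk u f \<Longrightarrow> cmod z < 1 \<Longrightarrow> (\<lambda>n. u n * z ^ n) sums f z"
  by (simp add: taylor_on_disk_def)

lemma taylor_on_disk_zero: "taylor_on_disk u f \<Longrightarrow> z \<notin> \<D> \<Longrightarrow> f z = 0"
  by (simp add: taylor_on_disk_def)

lemma hardy2_taylor:
  assumes "f \<in> hardy2"
  obtains u where "taylor_on_disk u f"
proof -
  have "taylor_on_disk (\<lambda>n. (deriv ^^ n) f 0 / fact n) f"
    using assms holomorphic_power_series[of f 0 1]
    by (auto simp: taylor_on_disk_def hardy2_def)
  with that show ?thesis .
qed

lemma taylor_on_disk_holomorphic:
  assumes "taylor_on_disk u f"
  shows "f holomorphic_on \<D>"
  by (rule power_series_holomorphic[of 0 1 u])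
     (use assms in \<open>auto simp: taylor_on_disk_def\<close>)

section \<open>Parseval's identity on circles\<close>

text \<open>Orthogonality of the characters: the product is a character of integer frequency
  \<open>n - m\<close>, and for nonzero frequency its antiderivative takes equal values at both ends
  of the period.\<close>

lemma has_integral_cis_nat_diff:
  fixes m n :: nat
  shows "((\<lambda>t. cis (real n * t) * cnj (cis (real m * t))) has_integral
           (if m = n then of_real (2 * pi) else 0)) {0..2 * pi}"
proof -
  define k where "k = int n - int m"
  have eq: "cis (real n * t) * cnj (cis (real m * t)) = cis (of_int k * t)" for t
    by (simp add: cis_cnj cis_mult k_def algebra_simps)
  show ?thesis
  proof (cases "k = 0")
    case True
    then show ?thesis
      using has_integral_const_real[of "1::complex" 0 "2 * pi"]
      unfolding eq by (auto simp: k_def scaleR_conv_of_real)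
  next
    case False
    have "((\<lambda>t. cis (of_int k * t)) has_integral
            (cis (of_int k * (2 * pi)) / (\<i> * of_int k) - cis (of_int k * 0) / (\<i> * of_int k))) {0..2 * pi}"
    proof (rule fundamental_theorem_of_calculus)
      fix t :: real
      show "((\<lambda>t. cis (of_int k * t) / (\<i> * of_int k)) has_vector_derivative cis (of_int k * t))
              (at t within {0..2 * pi})"
        using False unfolding cis_conv_exp
        by (auto intro!: derivative_eq_intros has_vector_derivative_real_field simp: field_simps)
    qed auto
    moreover have "cis (of_int k * (2 * pi)) = 1"
      using cis_multiple_2pi[of "of_int k"] by (simp add: mult.commute)
    ultimately show ?thesis
      using False unfolding eq by (auto simp: k_def)
  qed
qed

lemma has_integral_norm_square_trig_polynomial:
  "((\<lambda>t. (\<Sum>n<N. u n * cis (real n * t)) * cnj (\<Sum>n<N. u n * cis (real n * t))) has_integral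
      of_real (2 * pi) * (\<Sum>n<N. of_real ((cmod (u n))\<^sup>2))) {0..2 * pi}"
proof -
  have "((\<lambda>t. \<Sum>n<N. \<Sum>m<N. (u n * cnj (u m)) * (cis (real n * t) * cnj (cis (real m * t))))
      has_integral (\<Sum>n<N. \<Sum>m<N. (u n * cnj (u m)) * (if m = n then of_real (2 * pi) else 0)))
      {0..2 * pi}"
    by (intro has_integral_sum has_integral_mult_right has_integral_cis_nat_diff) auto
  moreover have "(\<Sum>n<N. \<Sum>m<N. (u n * cnj (u m)) * (if m = n then of_real (2 * pi) else 0))
      = of_real (2 * pi) * (\<Sum>n<N. of_real ((cmod (u n))\<^sup>2))"
    by (auto simp: if_distrib sum_distrib_left complex_norm_square mult_ac simp del: of_real_power cong: if_cong
             intro!: sum.cong)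
  ultimately show ?thesis
    by (simp add: cnj_sum sum_product mult_ac)
qed

text \<open>Parseval for trigonometric polynomials passes to the limit, since the partial sums of
  the Taylor series converge uniformly on the circle of radius \<open>r\<close>.\<close>

lemma mean_square_sums:
  assumes f: "taylor_on_disk u f" and r: "0 < r" "r < 1"
  shows "(\<lambda>n. (cmod (u n))\<^sup>2 * r ^ (2 * n)) sums mean_square f r"
proof -
  define S where "S = (\<lambda>N t. \<Sum>n<N. u n * of_real r ^ n * cis (real n * t))"
  define F where "F = (\<lambda>t. f (of_real r * cis t))"
  have term_eq: "u n * of_real r ^ n * cis (real n * t) = u n * (of_real r * cis t) ^ n" for n t
    by (simp add: power_mult_distrib Complex.DeMoivre)
  have "(\<lambda>n. u n * of_real r ^ n) sums f (of_real r)"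
    using r by (intro taylor_on_disk_sums[OF f]) auto
  have abs: "summable (\<lambda>n. cmod (u n * of_real r ^ n))"
  proof (rule powser_insidea)
    \<comment> \<open>The radius \<open>(1 + r) / 2\<close> lies strictly between \<open>r\<close>
      and 1, so convergence there gives absolute convergence at \<open>r\<close>.\<close>
    show "summable (\<lambda>n. u n * of_real ((1 + r) / 2) ^ n)"
      using r by (intro sums_summable[OF taylor_on_disk_sums[OF f]]) (auto simp: norm_mult simp del: of_real_add of_real_divide)
    show "cmod (of_real r) < cmod (of_real ((1 + r) / 2))"
      using r by (simp del: of_real_add of_real_divide)
  qed
  have "uniform_limit {0..2 * pi} S (\<lambda>t. \<Sum>n. u n * of_real r ^ n * cis (real n * t)) sequentially"
    unfolding S_def by (rule Weierstrass_m_test[OF _ abs]) (simp add: norm_mult)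
  moreover have "(\<Sum>n. u n * of_real r ^ n * cis (real n * t)) = F t" for t
    unfolding term_eq F_def using r
    by (intro sums_unique[symmetric] taylor_on_disk_sums[OF f]) (simp add: norm_mult)
  ultimately have lim: "uniform_limit {0..2 * pi} S F sequentially"
    by simp
  have contS: "continuous_on {0..2 * pi} (S N)" for N
    unfolding S_def by (intro continuous_intros)
  have contF: "continuous_on {0..2 * pi} F"
    by (rule uniform_limit_theorem[OF _ lim]) (simp_all add: contS)
  have bdd: "bounded (F ` {0..2 * pi})"
    by (intro compact_imp_bounded compact_continuous_image contF) auto
  \<comment> \<open>A product of uniform limits is a uniform limit when the limits are bounded;
    \<open>F\<close> is, being continuous on a compact interval.\<close>
  have "uniform_limit {0..2 * pi} (\<lambda>N t. S N t * cnj (S N t)) (\<lambda>t. F t * cnj (F t)) sequentially"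
  proof (rule bounded_bilinear.bounded_uniform_limit[OF bounded_bilinear_mult])
    show "uniform_limit {0..2 * pi} (\<lambda>N t. cnj (S N t)) (\<lambda>t. cnj (F t)) sequentially"
      using bounded_linear.uniform_limit[OF bounded_linear_cnj lim] .
    show "bounded ((\<lambda>t. cnj (F t)) ` {0..2 * pi})"
      using bdd by (simp add: bounded_iff)
  qed (use lim bdd in auto)
  then obtain I J where
    I: "\<And>N. ((\<lambda>t. S N t * cnj (S N t)) has_integral I N) {0..2 * pi}" and
    J: "((\<lambda>t. F t * cnj (F t)) has_integral J) {0..2 * pi}" and IJ: "I \<longlonglongrightarrow> J"
    by (rule uniform_limit_integral) (auto intro!: continuous_intros contS)
  have I_eq: "I = (\<lambda>N. of_real (2 * pi * (\<Sum>n<N. (cmod (u n))\<^sup>2 * r ^ (2 * n))))"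
  proof
    fix N
    have "((\<lambda>t. S N t * cnj (S N t)) has_integral
        of_real (2 * pi) * (\<Sum>n<N. of_real ((cmod (u n * of_real r ^ n))\<^sup>2))) {0..2 * pi}"
      unfolding S_def by (rule has_integral_norm_square_trig_polynomial)
    from has_integral_unique[OF I this] show "I N = of_real (2 * pi * (\<Sum>n<N. (cmod (u n))\<^sup>2 * r ^ (2 * n)))"
      using r by (simp add: norm_mult norm_power power_mult_distrib power_mult power2_eq_square mult_ac)
  qed
  have J_eq: "J = of_real (2 * pi * mean_square f r)"
  proof -
    have "(\<lambda>t. (cmod (F t))\<^sup>2) integrable_on {0..2 * pi}"
      by (intro integrable_continuous_real continuous_intros contF)
    then have "((\<lambda>t. of_real ((cmod (F t))\<^sup>2)) has_integral
        complex_of_real (integral {0..2 * pi} (\<lambda>t. (cmod (F t))\<^sup>2))) {0..2 * pi}"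
      by (intro has_integral_of_real integrable_integral)
    then have "((\<lambda>t. F t * cnj (F t)) has_integral
        complex_of_real (integral {0..2 * pi} (\<lambda>t. (cmod (F t))\<^sup>2))) {0..2 * pi}"
      by (simp only: complex_norm_square)
    from has_integral_unique[OF J this] show ?thesis
      by (simp add: mean_square_def F_def)
  qed
  from IJ have "(\<lambda>N. 2 * pi * (\<Sum>n<N. (cmod (u n))\<^sup>2 * r ^ (2 * n))) \<longlonglongrightarrow> 2 * pi * mean_square f r"
    unfolding I_eq J_eq by (rule tendsto_of_real_iff[THEN iffD1])
  then show ?thesis
    unfolding sums_def by (rule tendsto_mult_left_iff[THEN iffD1, rotated]) simp
qed

section \<open>The Hardy space as the \<open>\<ell>\<^sup>2\<close> space of Taylor
  coefficients\<close>

lemma mean_square_le_suminf: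
  assumes "taylor_on_disk u f" "0 < r" "r < 1" and sm: "summable (\<lambda>n. (cmod (u n))\<^sup>2)"
  shows "mean_square f r \<le> (\<Sum>n. (cmod (u n))\<^sup>2)"
proof (rule sums_le[OF _ mean_square_sums[OF assms(1-3)] summable_sums[OF sm]])
  show "(cmod (u n))\<^sup>2 * r ^ (2 * n) \<le> (cmod (u n))\<^sup>2" for n
    using assms by (intro mult_left_le power_le_one) auto
qed

text \<open>A finite partial sum is continuous in \<open>r\<close>, so letting \<open>r\<close> tend
  to 1 from below removes the weights \<open>r ^ (2 * n)\<close> while the bound \<open>B\<close>
  persists.\<close>

lemma sum_le_of_mean_square_le:
  assumes f: "taylor_on_disk u f" and B: "\<And>r. 0 < r \<Longrightarrow> r < 1 \<Longrightarrow> mean_square f r \<le> B"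
  shows "(\<Sum>n<N. (cmod (u n))\<^sup>2) \<le> B"
proof (rule tendsto_upperbound)
  show "((\<lambda>r. \<Sum>n<N. (cmod (u n))\<^sup>2 * r ^ (2 * n)) \<longlongrightarrow> (\<Sum>n<N. (cmod (u n))\<^sup>2)) (at_left 1)"
    by (auto intro!: tendsto_eq_intros)
  have "eventually (\<lambda>r::real. 0 < r \<and> r < 1) (at_left 1)"
    using eventually_at_left_real[of 0 1] by simp
  then show "eventually (\<lambda>r. (\<Sum>n<N. (cmod (u n))\<^sup>2 * r ^ (2 * n)) \<le> B) (at_left 1)"
  proof eventually_elim
    case (elim r)
    have "(\<Sum>n<N. (cmod (u n))\<^sup>2 * r ^ (2 * n)) \<le> mean_square f r"
      using mean_square_sums[OF f, of r] elim
      by (metis (no_types, lifting) mult_nonneg_nonneg order_less_imp_le sum_le_suminf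
          sums_iff zero_le_power zero_le_power2 finite_lessThan)
    with B[of r] elim show ?case by simp
  qed
qed simp

lemma hardy2_iff_summable:
  assumes f: "taylor_on_disk u f"
  shows "f \<in> hardy2 \<longleftrightarrow> summable (\<lambda>n. (cmod (u n))\<^sup>2)"
proof
  assume "f \<in> hardy2"
  then obtain B where "\<forall>r\<in>{0<..<1}. mean_square f r \<le> B"
    by (auto simp: hardy2_def bdd_above_def)
  then have "mean_square f r \<le> B" if "0 < r" "r < 1" for r
    using that by simp
  from sum_le_of_mean_square_le[OF f this] show "summable (\<lambda>n. (cmod (u n))\<^sup>2)"
    by (intro summableI_nonneg_bounded) auto
next
  assume "summable (\<lambda>n. (cmod (u n))\<^sup>2)"
  then have "bdd_above (mean_square f ` {0<..<1})"
    using mean_square_le_suminf[OF f] by (intro bdd_aboveI2) auto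
  then show "f \<in> hardy2"
    using taylor_on_disk_holomorphic[OF f] taylor_on_disk_zero[OF f] by (simp add: hardy2_def)
qed

lemma hardy_norm_square:
  assumes f: "taylor_on_disk u f" and sm: "summable (\<lambda>n. (cmod (u n))\<^sup>2)"
  shows "(hardy_norm f)\<^sup>2 = (\<Sum>n. (cmod (u n))\<^sup>2)"
proof -
  have bdd: "bdd_above (mean_square f ` {0<..<1})"
    using mean_square_le_suminf[OF f _ _ sm] by (intro bdd_aboveI2) auto
  have "(SUP r\<in>{0<..<1}. mean_square f r) = (\<Sum>n. (cmod (u n))\<^sup>2)"
  proof (rule antisym)
    show "(SUP r\<in>{0<..<1}. mean_square f r) \<le> (\<Sum>n. (cmod (u n))\<^sup>2)"
      using mean_square_le_suminf[OF f _ _ sm] by (intro cSUP_least) auto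
    show "(\<Sum>n. (cmod (u n))\<^sup>2) \<le> (SUP r\<in>{0<..<1}. mean_square f r)"
      by (intro suminf_le_const[OF sm] sum_le_of_mean_square_le[OF f] cSUP_upper bdd) auto
  qed
  then show ?thesis
    by (simp add: hardy_norm_def suminf_nonneg[OF sm])
qed

text \<open>The scalar case of the formula defining \<open>hardy_inner\<close>, to be applied to
  each pair of Taylor coefficients.\<close>

lemma polarization:
  fixes x y :: complex
  shows "(\<Sum>k<4. \<i> ^ k * of_real ((cmod (x + \<i> ^ k * y))\<^sup>2)) / 4 = x * cnj y"
  by (simp only: complex_norm_square) (simp add: eval_nat_numeral algebra_simps)

text \<open>Each of the four norms is the \<open>\<ell>\<^sup>2\<close> norm of the sequence
  \<open>u n + \<i> ^ k * v n\<close>; combining the four series termwise leaves the scalar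
  polarization identity.\<close>

lemma hardy_inner_sums:
  assumes f: "taylor_on_disk u f" and g: "taylor_on_disk v g"
    and u: "summable (\<lambda>n. (cmod (u n))\<^sup>2)" and v: "summable (\<lambda>n. (cmod (v n))\<^sup>2)"
  shows "(\<lambda>n. u n * cnj (v n)) sums hardy_inner f g"
proof -
  have "(\<lambda>n. (cmod (u n + \<i> ^ k * v n))\<^sup>2) sums (hardy_norm (\<lambda>z. f z + \<i> ^ k * g z))\<^sup>2" for k
  proof -
    have t: "taylor_on_disk (\<lambda>n. u n + \<i> ^ k * v n) (\<lambda>z. f z + \<i> ^ k * g z)"
      using f g sums_add[OF _ sums_mult[of _ _ "\<i> ^ k"]]
      by (fastforce simp: taylor_on_disk_def ring_distribs mult.assoc)
    \<comment> \<open>This majorant supplies the square summability under which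
      \<open>hardy_norm_square\<close> applies to the combination.\<close>
    have "(cmod (u n + \<i> ^ k * v n))\<^sup>2 \<le> 2 * (cmod (u n))\<^sup>2 + 2 * (cmod (v n))\<^sup>2" for n
    proof -
      have "cmod (u n + \<i> ^ k * v n) \<le> cmod (u n) + cmod (v n)"
        using norm_triangle_ineq[of "u n" "\<i> ^ k * v n"] by (simp add: norm_mult norm_power)
      then have "(cmod (u n + \<i> ^ k * v n))\<^sup>2 \<le> (cmod (u n) + cmod (v n))\<^sup>2"
        by (intro power_mono) auto
      also have "\<dots> \<le> 2 * (cmod (u n))\<^sup>2 + 2 * (cmod (v n))\<^sup>2"
        using zero_le_power2[of "cmod (u n) - cmod (v n)"]
        by (simp add: power2_eq_square algebra_simps)
      finally show ?thesis .
    qed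
    then have "summable (\<lambda>n. (cmod (u n + \<i> ^ k * v n))\<^sup>2)"
      by (intro summable_comparison_test'[OF summable_add[OF summable_mult[OF u] summable_mult[OF v]]])
         simp
    with hardy_norm_square[OF t] show ?thesis
      by (simp add: summable_sums)
  qed
  then have "(\<lambda>n. (\<Sum>k<4. \<i> ^ k * of_real ((cmod (u n + \<i> ^ k * v n))\<^sup>2)) / 4) sums hardy_inner f g"
    unfolding hardy_inner_def by (intro sums_divide sums_sum sums_mult sums_of_real)
  then show ?thesis
    by (simp only: polarization)
qed

text \<open>Inner products with the monomials recover the Taylor coefficients. This gives the
  uniqueness behind the definite description in \<open>hardy_adjoint\<close>.\<close>

lemma hardy2_eqI:
  assumes g: "g \<in> hardy2" and h: "h \<in> hardy2"
    and eq: "\<And>f. f \<in> hardy2 \<Longrightarrow> hardy_inner f g = hardy_inner f h"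
  shows "g = h"
proof -
  obtain v w where v: "taylor_on_disk v g" and w: "taylor_on_disk w h"
    using g h hardy2_taylor by metis
  have vw: "v k = w k" for k
  proof -
    \<comment> \<open>\<open>m\<close> is the monomial z^k cut off outside the disk, and
      \<open>e\<close> is its coefficient sequence.\<close>
    define e where "e = (\<lambda>n. if n = k then 1 else 0 :: complex)"
    define m where "m = (\<lambda>z::complex. if z \<in> \<D> then z ^ k else 0)"
    have single: "(\<lambda>n. e n * x n) sums x k" for x
    proof -
      have "(\<lambda>n. e n * x n) = (\<lambda>n. if n = k then x n else 0)"
        by (auto simp: e_def)
      then show ?thesis
        using sums_single[of k x] by simp
    qed
    have m: "taylor_on_disk e m"
      using single by (auto simp: taylor_on_disk_def m_def)
    have e: "summable (\<lambda>n. (cmod (e n))\<^sup>2)"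
      by (rule summable_finite[of "{k}"]) (auto simp: e_def)
    then have "m \<in> hardy2"
      using hardy2_iff_summable[OF m] by simp
    have "hardy_inner m p = cnj (x k)" if x: "taylor_on_disk x p" and p: "p \<in> hardy2" for x p
    proof -
      have "summable (\<lambda>n. (cmod (x n))\<^sup>2)"
        using hardy2_iff_summable[OF x] p by simp
      from hardy_inner_sums[OF m x e this] single[of "\<lambda>n. cnj (x n)"] show ?thesis
        by (rule sums_unique2)
    qed
    from this[OF v g] this[OF w h] eq[OF \<open>m \<in> hardy2\<close>] show ?thesis
      by simp
  qed
  show ?thesis
  proof
    fix z
    show "g z = h z"
    proof (cases "z \<in> \<D>")
      case True
      then have "(\<lambda>n. v n * z ^ n) sums g z" "(\<lambda>n. v n * z ^ n) sums h z"
        using taylor_on_disk_sums[OF v, of z] taylor_on_disk_sums[OF w, of z] by (simp_all add: vw)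
      then show ?thesis
        by (rule sums_unique2)
    next
      case False
      then show ?thesis
        using taylor_on_disk_zero[OF v] taylor_on_disk_zero[OF w] by simp
    qed
  qed
qed

text \<open>Reduces the computation of an adjoint to exhibiting a candidate in \<open>hardy2\<close>
  and checking the adjoint relation.\<close>

lemma hardy_adjoint_eqI:
  assumes "h \<in> hardy2" "\<And>f. f \<in> hardy2 \<Longrightarrow> hardy_inner (T f) g = hardy_inner f h"
  shows "hardy_adjoint T g = h"
  unfolding hardy_adjoint_def
  using assms by (intro the_equality) (auto intro!: hardy2_eqI)

lemma disk_self_map_in_disk: "disk_self_map \<phi> \<Longrightarrow> cmod z < 1 \<Longrightarrow> cmod (\<phi> z) < 1"
  unfolding disk_self_map_def by (metis dist_0_norm image_subset_iff mem_ball)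

section \<open>Szego kernels and adjoints of composition operators\<close>

definition szego_kernel :: "complex \<Rightarrow> complex \<Rightarrow> complex" where
  "szego_kernel w = (\<lambda>z. if z \<in> \<D> then 1 / (1 - cnj w * z) else 0)"

lemma taylor_on_disk_szego_kernel:
  assumes "w \<in> \<D>"
  shows "taylor_on_disk (\<lambda>n. cnj w ^ n) (szego_kernel w)"
proof -
  have "(\<lambda>n. (cnj w * z) ^ n) sums (1 / (1 - cnj w * z))" if "z \<in> \<D>" for z
    using assms that mult_strict_mono'[of "cmod w" 1 "cmod z" 1]
    by (intro geometric_sums) (simp add: norm_mult)
  then show ?thesis
    by (simp add: taylor_on_disk_def szego_kernel_def power_mult_distrib)
qed

lemma summable_szego_kernel:
  assumes "w \<in> \<D>"
  shows "summable (\<lambda>n. (cmod (cnj w ^ n))\<^sup>2)"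
proof -
  have "(\<lambda>n. (cmod (cnj w ^ n))\<^sup>2) = (\<lambda>n. ((cmod w)\<^sup>2) ^ n)"
    by (simp add: norm_power flip: power_mult) (simp add: mult.commute)
  moreover have "(cmod w)\<^sup>2 < 1"
    using assms by (simp add: power2_eq_square mult_strict_mono'[of "cmod w" 1 "cmod w" 1, simplified])
  ultimately show ?thesis
    by (simp add: summable_geometric)
qed

lemma szego_kernel_hardy2: "w \<in> \<D> \<Longrightarrow> szego_kernel w \<in> hardy2"
  using hardy2_iff_summable taylor_on_disk_szego_kernel summable_szego_kernel by blast

text \<open>The kernel has coefficients \<open>cnj w ^ n\<close>, so the inner product series is the
  Taylor series of \<open>f\<close> at \<open>w\<close>.\<close>

lemma hardy_inner_szego_kernel:
  assumes f: "f \<in> hardy2" and w: "w \<in> \<D>"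
  shows "hardy_inner f (szego_kernel w) = f w"
proof -
  obtain u where u: "taylor_on_disk u f"
    using hardy2_taylor[OF f] .
  have "(\<lambda>n. u n * w ^ n) sums hardy_inner f (szego_kernel w)"
    using hardy_inner_sums[OF u taylor_on_disk_szego_kernel[OF w] _ summable_szego_kernel[OF w]]
      f hardy2_iff_summable[OF u] by simp
  moreover have "(\<lambda>n. u n * w ^ n) sums f w"
    using u w by (simp add: taylor_on_disk_def)
  ultimately show ?thesis
    by (rule sums_unique2)
qed

text \<open>By the reproducing property, both sides of the adjoint relation equal
  \<open>f (\<phi> w)\<close>.\<close>

lemma hardy_adjoint_composition_szego_kernel:
  assumes T: "hardy_bounded_operator (composition_operator \<phi>)" and \<phi>: "disk_self_map \<phi>"
    and w: "w \<in> \<D>"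
  shows "hardy_adjoint (composition_operator \<phi>) (szego_kernel w) = szego_kernel (\<phi> w)"
proof (rule hardy_adjoint_eqI)
  have \<phi>w: "\<phi> w \<in> \<D>"
    using \<phi> w by (simp add: disk_self_map_in_disk)
  then show "szego_kernel (\<phi> w) \<in> hardy2"
    by (rule szego_kernel_hardy2)
  fix f assume f: "f \<in> hardy2"
  then have "composition_operator \<phi> f \<in> hardy2"
    using T by (simp add: hardy_bounded_operator_def)
  then show "hardy_inner (composition_operator \<phi> f) (szego_kernel w)
      = hardy_inner f (szego_kernel (\<phi> w))"
    using f w \<phi>w by (simp add: hardy_inner_szego_kernel) (simp add: composition_operator_def)
qed

lemma composition_szego_kernel_0:
  assumes "disk_self_map \<phi>"
  shows "composition_operator \<phi> (szego_kernel 0) = szego_kernel 0"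
  using disk_self_map_in_disk[OF assms] by (auto simp: composition_operator_def szego_kernel_def)

lemma hardy_J_szego_kernel_0: "hardy_J (szego_kernel 0) = szego_kernel 0"
  by (auto simp: hardy_J_def szego_kernel_def)

section \<open>Each condition forces the origin to be fixed\<close>

lemma two_complex_symmetric_fixes_0:
  assumes \<phi>: "disk_self_map \<phi>"
    and T: "two_complex_symmetric hardy_J (composition_operator \<phi>)"
  shows "\<phi> 0 = 0"
proof -
  define p q where "p = cnj (\<phi> 0)" and "q = cnj (\<phi> (\<phi> 0))"
  have \<phi>0: "\<phi> 0 \<in> \<D>" and \<phi>\<phi>0: "\<phi> (\<phi> 0) \<in> \<D>"
    using \<phi> by (simp_all add: disk_self_map_in_disk)
  have bdd: "hardy_bounded_operator (composition_operator \<phi>)"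
    using T by (simp add: two_complex_symmetric_def)
  have id: "szego_kernel 0 z - 2 * szego_kernel (\<phi> 0) z + szego_kernel (\<phi> (\<phi> 0)) z = 0" for z
    using T szego_kernel_hardy2[of 0] \<phi>0
    by (auto simp: two_complex_symmetric_def composition_szego_kernel_0[OF \<phi>]
        hardy_J_szego_kernel_0 hardy_adjoint_composition_szego_kernel[OF bdd \<phi>]
        dest!: bspec[of _ _ "szego_kernel 0"])
  \<comment> \<open>Clearing denominators in the kernel identity leaves a quadratic polynomial in
    \<open>z\<close> without constant term; its vanishing on the disk forces both coefficients to be
    0.\<close>
  have "(q - 2 * p) * z + p * q * z\<^sup>2 = 0" if z: "cmod z < 1" for z
  proof -
    have nz: "1 - cnj w * z \<noteq> 0" if "w \<in> \<D>" for w
      using that z mult_strict_mono'[of "cmod w" 1 "cmod z" 1]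
      by (metis complex_mod_cnj dist_0_norm less_irrefl mem_ball mult_1 norm_ge_zero norm_mult norm_one
          right_minus_eq)
    have "1 - 2 / (1 - p * z) + 1 / (1 - q * z) = 0"
      using id[of z] z by (simp add: szego_kernel_def p_def q_def)
    then show ?thesis
      using nz[OF \<phi>0] nz[OF \<phi>\<phi>0] unfolding p_def[symmetric] q_def[symmetric]
      by (simp add: divide_simps) (simp add: algebra_simps power2_eq_square)
  qed
  \<comment> \<open>Two opposite points separate the odd part from the even part: adding gives
    \<open>p * q = 0\<close>, then \<open>q = 2 * p\<close>, hence \<open>p = 0\<close>.\<close>
  from this[of "1/2"] this[of "-1/2"]
  have half: "(q - 2 * p) + p * q / 2 = 0" "- (q - 2 * p) + p * q / 2 = 0"
    by (simp_all add: power2_eq_square field_simps)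
  have "p * q = ((q - 2 * p) + p * q / 2) + (- (q - 2 * p) + p * q / 2)"
    by simp
  then have pq: "p * q = 0"
    unfolding half by simp
  have "q = 2 * p"
    using half(1) unfolding pq by simp
  with pq have "p = 0"
    by auto
  then show ?thesis
    by (auto simp: p_def)
qed

lemma hardy_normal_fixes_0:
  assumes \<phi>: "disk_self_map \<phi>" and T: "hardy_normal (composition_operator \<phi>)"
  shows "\<phi> 0 = 0"
proof -
  have \<phi>0: "\<phi> 0 \<in> \<D>"
    using \<phi> by (simp add: disk_self_map_in_disk)
  have bdd: "hardy_bounded_operator (composition_operator \<phi>)"
    using T by (simp add: hardy_normal_def)
  have "szego_kernel (\<phi> 0) = composition_operator \<phi> (szego_kernel (\<phi> 0))"
    using T szego_kernel_hardy2[of 0]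
    by (auto simp: hardy_normal_def composition_szego_kernel_0[OF \<phi>]
        hardy_adjoint_composition_szego_kernel[OF bdd \<phi>] dest!: bspec[of _ _ "szego_kernel 0"])
  \<comment> \<open>At 0 the left side is 1 and the right side is the kernel at
    \<open>\<phi> 0\<close> evaluated at \<open>\<phi> 0\<close> itself; equality makes the squared
    modulus of \<open>\<phi> 0\<close> vanish.\<close>
  from fun_cong[OF this, of 0] have "1 / (1 - cnj (\<phi> 0) * \<phi> 0) = 1"
    using \<phi>0 by (simp add: szego_kernel_def composition_operator_def)
  then show ?thesis
    by (auto simp: divide_eq_1_iff)
qed

section \<open>Dilations as diagonal operators\<close>

lemma taylor_on_disk_dilation:
  assumes f: "taylor_on_disk u f" and "cmod \<alpha> \<le> 1"
  shows "taylor_on_disk (\<lambda>n. \<alpha> ^ n * u n) (composition_operator (\<lambda>z. \<alpha> * z) f)"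
proof -
  have "(\<lambda>n. u n * (\<alpha> * z) ^ n) sums f (\<alpha> * z)" if "z \<in> \<D>" for z
    using that assms(2) mult_left_le_one_le[of "cmod z" "cmod \<alpha>"]
    by (intro taylor_on_disk_sums[OF f]) (simp add: norm_mult)
  then show ?thesis
    by (simp add: taylor_on_disk_def composition_operator_def power_mult_distrib mult_ac)
qed

lemma summable_dilation:
  fixes u :: "nat \<Rightarrow> complex"
  assumes "summable (\<lambda>n. (cmod (u n))\<^sup>2)" "cmod \<alpha> \<le> 1"
  shows "summable (\<lambda>n. (cmod (\<alpha> ^ n * u n))\<^sup>2)"
proof (rule summable_comparison_test'[OF assms(1)])
  show "norm ((cmod (\<alpha> ^ n * u n))\<^sup>2) \<le> (cmod (u n))\<^sup>2" for n
    using assms(2)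
    by (simp add: norm_mult norm_power power_le_one power_mono mult_left_le_one_le)
qed

text \<open>The operator multiplies the n-th coefficient by \<open>\<alpha> ^ n\<close>, so its
  adjoint multiplies it by the conjugate \<open>cnj \<alpha> ^ n\<close>, which is again a
  dilation.\<close>

lemma hardy_adjoint_dilation:
  assumes \<alpha>: "cmod \<alpha> \<le> 1" and g: "g \<in> hardy2"
  shows "hardy_adjoint (composition_operator (\<lambda>z. \<alpha> * z)) g = composition_operator (\<lambda>z. cnj \<alpha> * z) g"
proof (rule hardy_adjoint_eqI)
  obtain v where v: "taylor_on_disk v g"
    using hardy2_taylor[OF g] .
  have c\<alpha>: "cmod (cnj \<alpha>) \<le> 1"
    using \<alpha> by simp
  note tv = taylor_on_disk_dilation[OF v c\<alpha>]
  have sv: "summable (\<lambda>n. (cmod (v n))\<^sup>2)"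
    using g hardy2_iff_summable[OF v] by simp
  note sv' = summable_dilation[OF sv c\<alpha>]
  show "composition_operator (\<lambda>z. cnj \<alpha> * z) g \<in> hardy2"
    using hardy2_iff_summable[OF tv] sv' by simp
  fix f assume f: "f \<in> hardy2"
  obtain u where u: "taylor_on_disk u f"
    using hardy2_taylor[OF f] .
  have su: "summable (\<lambda>n. (cmod (u n))\<^sup>2)"
    using f hardy2_iff_summable[OF u] by simp
  show "hardy_inner (composition_operator (\<lambda>z. \<alpha> * z) f) g
      = hardy_inner f (composition_operator (\<lambda>z. cnj \<alpha> * z) g)"
    using hardy_inner_sums[OF taylor_on_disk_dilation[OF u \<alpha>] v summable_dilation[OF su \<alpha>] sv]
      hardy_inner_sums[OF u tv su sv']
    by (auto simp: mult_ac intro: sums_unique2)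
qed

lemma dilation_hardy2:
  assumes "f \<in> hardy2" "cmod \<alpha> \<le> 1"
  shows "composition_operator (\<lambda>z. \<alpha> * z) f \<in> hardy2"
proof -
  obtain u where "taylor_on_disk u f"
    using hardy2_taylor[OF assms(1)] .
  with assms show ?thesis
    using hardy2_iff_summable taylor_on_disk_dilation summable_dilation by blast
qed

text \<open>Adjoints and conjugates of dilations are dilations, and dilations commute. Boundedness
  is part of each of the two conditions, so either one can supply the hypothesis
  \<open>T\<close>.\<close>

lemma
  assumes T: "hardy_bounded_operator (composition_operator (\<lambda>z. \<alpha> * z))" and \<alpha>: "cmod \<alpha> \<le> 1"
  shows hardy_normal_dilation: "hardy_normal (composition_operator (\<lambda>z. \<alpha> * z))"
    and two_complex_symmetric_dilation:
      "two_complex_symmetric hardy_J (composition_operator (\<lambda>z. \<alpha> * z))"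
proof -
  let ?C = "\<lambda>\<alpha>. composition_operator (\<lambda>z. \<alpha> * z)"
  have c\<alpha>: "cmod (cnj \<alpha>) \<le> 1"
    using \<alpha> by simp
  have disk: "cmod (\<beta> * z) < 1" if "cmod \<beta> \<le> 1" "cmod z < 1" for \<beta> z
    using that mult_left_le_one_le[of "cmod z" "cmod \<beta>"] by (simp add: norm_mult)
  \<comment> \<open>The bound on \<open>\<beta>\<close> keeps \<open>\<beta> * z\<close> inside the
    disk, so the default value 0 of the inner composition does not interfere.\<close>
  have comp: "?C \<beta> (?C \<gamma> f) = ?C (\<gamma> * \<beta>) f" if "cmod \<beta> \<le> 1" for \<beta> \<gamma> f
    using disk[OF that] by (auto simp: composition_operator_def mult.assoc)
  have conj: "hardy_J (?C \<beta> (hardy_J f)) = ?C (cnj \<beta>) f" for \<beta> f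
    by (auto simp: composition_operator_def hardy_J_def)
  have "hardy_adjoint (?C \<alpha>) (?C \<alpha> f) = ?C \<alpha> (hardy_adjoint (?C \<alpha>) f)" if "f \<in> hardy2" for f
    using that \<alpha> c\<alpha> by (simp add: hardy_adjoint_dilation dilation_hardy2 comp mult.commute[of "cnj \<alpha>" \<alpha>])
  with T show "hardy_normal (?C \<alpha>)"
    by (simp add: hardy_normal_def)
  \<comment> \<open>Each of the three operators becomes the dilation by the square of
    \<open>cnj \<alpha>\<close>, and the weights 1, -2, 1 cancel.\<close>
  have "hardy_J (?C \<alpha> (?C \<alpha> (hardy_J f))) z - 2 * hardy_adjoint (?C \<alpha>) (hardy_J (?C \<alpha> (hardy_J f))) z
      + hardy_adjoint (?C \<alpha>) (hardy_adjoint (?C \<alpha>) f) z = 0" if "f \<in> hardy2" for f z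
    using that \<alpha> c\<alpha> by (simp add: hardy_adjoint_dilation dilation_hardy2 comp conj)
  with T show "two_complex_symmetric hardy_J (?C \<alpha>)"
    by (simp add: two_complex_symmetric_def)
qed

text \<open>Otherwise \<open>1 / \<alpha>\<close> would be a point of the disk sent to 1.\<close>

lemma disk_self_map_dilation_norm:
  assumes "disk_self_map (\<lambda>z. \<alpha> * z)"
  shows "cmod \<alpha> \<le> 1"
proof (rule ccontr)
  assume *: "\<not> cmod \<alpha> \<le> 1"
  then have "1 / \<alpha> \<in> \<D>"
    by (simp add: norm_divide divide_simps)
  with assms have "\<alpha> * (1 / \<alpha>) \<in> \<D>"
    unfolding disk_self_map_def by blast
  with * show False
    by (auto split: if_splits)
qed

theorem theorem3:
  fixes a b c d :: complex and \<phi> :: "complex \<Rightarrow> complex"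
  assumes "\<phi> = (\<lambda>z. (a * z + b) / (c * z + d))"
    and "a * d - b * c \<noteq> 0"
    and "disk_self_map \<phi>"
    and "c = 0"
  shows "two_complex_symmetric hardy_J (composition_operator \<phi>)
           \<longleftrightarrow> hardy_normal (composition_operator \<phi>)"
proof -
  \<comment> \<open>With \<open>c = 0\<close> the determinant condition gives nonzero
    \<open>d\<close>, so \<open>\<phi> 0 = b / d\<close> vanishes only if
    \<open>b = 0\<close>.\<close>
  have dilation: "\<phi> = (\<lambda>z. a / d * z)" "cmod (a / d) \<le> 1" if "\<phi> 0 = 0"
  proof -
    show "\<phi> = (\<lambda>z. a / d * z)"
      using that assms by auto
    with assms(3) show "cmod (a / d) \<le> 1"
      using disk_self_map_dilation_norm by blast
  qed
  show ?thesis
  proof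
    assume T: "two_complex_symmetric hardy_J (composition_operator \<phi>)"
    note \<phi> = dilation[OF two_complex_symmetric_fixes_0[OF assms(3) T]]
    show "hardy_normal (composition_operator \<phi>)"
      using T \<phi>(2) hardy_normal_dilation unfolding \<phi>(1) two_complex_symmetric_def by blast
  next
    assume T: "hardy_normal (composition_operator \<phi>)"
    note \<phi> = dilation[OF hardy_normal_fixes_0[OF assms(3) T]]
    show "two_complex_symmetric hardy_J (composition_operator \<phi>)"
      using T \<phi>(2) two_complex_symmetric_dilation unfolding \<phi>(1) hardy_normal_def by blast
  qed
qed

end
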